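(* Let $k$ be an algebraically closed field of positive characteristic. Let $A$ be a finite-dimensional basic $k$-algebra such that the Gabriel quiver $Q_A$ of $A$ does not have any loops. Let $B$ be a subalgebra of $A$ with Gabriel quiver $Q_B$ such that $Q_B\subseteq Q_A$, and let $Q_C$ be the quiver with the same vertices as $Q_A$ whose arrows are the arrows of $Q_A$ that are not arrows of $Q_B$. If $Q_C$ is a simple directed graph, then $\mathrm{HH}^1(A|B)$ is a strongly solvable Lie algebra.
   Context: Relative first Hochschild cohomology: $\mathrm{HH}^1(A|B)=\mathrm{Der}_{B^e}(A)/\mathrm{Inn}_{B^e}(A)$, where $\mathrm{Der}_{B^e}(A)$ (resp. $\mathrm{Inn}_{B^e}(A)$) is the space of $k$-derivations (resp. inner derivations) of $A$ that are $B$-bimodule homomorphisms, equivalently vanish on $B$; the Lie bracket is induced by the commutator. A Lie algebra $\mathfrak g$ is strongly solvable if its derived subalgebra $[\mathfrak g,\mathfrak g]$ is nilpotent. A simple directed graph here means a quiver with no loops and no two distinct parallel arrows (arrows with the same source and the same target). Convention: $Q_B\subseteq Q_A$ is understood compatibly with $B\subseteq A$: $Q_A$ and $Q_B$ have the same vertices (so $A$ and $B$ have the same semisimple part), and there are surjections $\nu_A:kQ_A\to A$, $\nu_B:kQ_B\to B$ with admissible kernels such that $\nu_A|_{kQ_B}$ equals $\nu_B$ followed by the inclusion $B\subseteq A$. *)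

theory Defs
  imports
    "HOL-Algebra.Module"
    "HOL-Algebra.QuotRing"
    "HOL-Algebra.Ideal_Product"
    "HOL-Computational_Algebra.Polynomial"
    "HOL-Library.Poly_Mapping"
    "Graph_Theory.Graph_Theory"
begin

section \<open>Algebras over a field and their subalgebras\<close>

locale k_algebra = vector_space scale
  for scale :: "'k::field \<Rightarrow> 'a::ring_1 \<Rightarrow> 'a" +
  assumes scale_mult_left: "scale c x * y = scale c (x * y)"
    and scale_mult_right: "x * scale c y = scale c (x * y)"

definition finite_dimensional :: "('k::field \<Rightarrow> 'a::ring_1 \<Rightarrow> 'a) \<Rightarrow> bool" where
  "finite_dimensional scale \<longleftrightarrow> (\<exists>X. finite X \<and> Modules.module.span scale X = UNIV)"

definition subalgebra :: "('k::field \<Rightarrow> 'a::ring_1 \<Rightarrow> 'a) \<Rightarrow> 'a set \<Rightarrow> bool" where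
  "subalgebra scale S \<longleftrightarrow>
     Modules.module.subspace scale S \<and> 1 \<in> S \<and> (\<forall>x\<in>S. \<forall>y\<in>S. x * y \<in> S)"

definition ring_on :: "'a::ring_1 set \<Rightarrow> 'a ring" where
  "ring_on S = \<lparr>carrier = S, monoid.mult = (*), one = 1, zero = 0, add = (+)\<rparr>"


section \<open>Basic algebras, Jacobson radical, Gabriel quiver\<close>

text \<open>All notions in this section are relative to a (unital) subalgebra \<open>S\<close> of the ambient
  algebra; the case of the whole algebra is \<open>S = UNIV\<close>.\<close>

definition right_ideal :: "'a::ring_1 set \<Rightarrow> 'a set \<Rightarrow> bool" where
  "right_ideal S I \<longleftrightarrow> I \<subseteq> S \<and> 0 \<in> I \<and> (\<forall>x\<in>I. \<forall>y\<in>I. x + y \<in> I) \<and>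
     (\<forall>x\<in>I. \<forall>a\<in>S. x * a \<in> I)"

definition maximal_right_ideal :: "'a::ring_1 set \<Rightarrow> 'a set \<Rightarrow> bool" where
  "maximal_right_ideal S I \<longleftrightarrow> right_ideal S I \<and> I \<noteq> S \<and>
     (\<forall>I'. right_ideal S I' \<and> I \<subseteq> I' \<longrightarrow> I' = I \<or> I' = S)"

definition jacobson_radical :: "'a::ring_1 set \<Rightarrow> 'a set" where
  "jacobson_radical S = S \<inter> \<Inter>{I. maximal_right_ideal S I}"

definition idempotent_in :: "'a::ring_1 set \<Rightarrow> 'a \<Rightarrow> bool" where
  "idempotent_in S e \<longleftrightarrow> e \<in> S \<and> e * e = e"

definition primitive_idempotent :: "'a::ring_1 set \<Rightarrow> 'a \<Rightarrow> bool" where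
  "primitive_idempotent S e \<longleftrightarrow> idempotent_in S e \<and> e \<noteq> 0 \<and>
     (\<forall>f g. idempotent_in S f \<and> idempotent_in S g \<and> f * g = 0 \<and> g * f = 0 \<and> e = f + g
        \<longrightarrow> f = 0 \<or> g = 0)"

text \<open>The right modules \<open>eS\<close> and \<open>fS\<close> are the images of \<open>S\<close> under left multiplication;
  \<open>S\<close>-linear bijections between them are automatically linear over the ground field.\<close>

definition iso_right_projectives :: "'a::ring_1 set \<Rightarrow> 'a \<Rightarrow> 'a \<Rightarrow> bool" where
  "iso_right_projectives S e f \<longleftrightarrow>
     (\<exists>\<phi>. bij_betw \<phi> ((*) e ` S) ((*) f ` S) \<and>
        (\<forall>x\<in>(*) e ` S. \<forall>y\<in>(*) e ` S. \<phi> (x + y) = \<phi> x + \<phi> y) \<and>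
        (\<forall>x\<in>(*) e ` S. \<forall>a\<in>S. \<phi> (x * a) = \<phi> x * a))"

definition basic_idempotents :: "'a::ring_1 set \<Rightarrow> 'i set \<Rightarrow> ('i \<Rightarrow> 'a) \<Rightarrow> bool" where
  "basic_idempotents S I e \<longleftrightarrow> finite I \<and> (\<forall>i\<in>I. primitive_idempotent S (e i)) \<and>
     (\<forall>i\<in>I. \<forall>j\<in>I. i \<noteq> j \<longrightarrow> e i * e j = 0 \<and> \<not> iso_right_projectives S (e i) (e j)) \<and>
     (\<Sum>i\<in>I. e i) = 1"

definition basic_algebra :: "'a::ring_1 set \<Rightarrow> bool" where
  "basic_algebra S \<longleftrightarrow> (\<exists>(n::nat) e. basic_idempotents S {..<n} e)"

text \<open>The number of arrows from \<open>u\<close> to \<open>v\<close> is the dimension of \<open>e\<^sub>u (J / J\<^sup>2) e\<^sub>v\<close>,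
  where \<open>J\<close> is the Jacobson radical. This space is \<open>e\<^sub>u J e\<^sub>v / e\<^sub>u J\<^sup>2 e\<^sub>v\<close>, so its
  dimension is a difference, written below without subtraction. The order of \<open>u\<close> and \<open>v\<close>
  agrees with composing paths from left to right.\<close>

definition gabriel_quiver ::
  "('k::field \<Rightarrow> 'a::ring_1 \<Rightarrow> 'a) \<Rightarrow> 'a set \<Rightarrow> ('v, 'e) pre_digraph \<Rightarrow> bool" where
  "gabriel_quiver scale S Q \<longleftrightarrow> fin_digraph Q \<and>
     (\<exists>e. basic_idempotents S (verts Q) e \<and>
       (let J = jacobson_radical S; J2 = J \<cdot>\<^bsub>ring_on S\<^esub> J in
        \<forall>u\<in>verts Q. \<forall>v\<in>verts Q.
          vector_space.dim scale ((\<lambda>x. e u * x * e v) ` J) =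
          vector_space.dim scale ((\<lambda>x. e u * x * e v) ` J2) +
            card {a \<in> arcs Q. tail Q a = u \<and> head Q a = v}))"


section \<open>Path algebras\<close>

text \<open>A path is a triple of its source, its list of arrows and its target; the trivial path at
  \<open>v\<close> is \<open>(v, [], v)\<close>. Elements of the path algebra are the finitely supported
  coefficient functions on paths, and paths are composed from left to right.\<close>

type_synonym ('v, 'e) qpath = "'v \<times> 'e list \<times> 'v"

definition qpaths :: "('v, 'e) pre_digraph \<Rightarrow> ('v, 'e) qpath set" where
  "qpaths Q = {(u, p, v). pre_digraph.awalk Q u p v}"

fun path_mult :: "('v, 'e) qpath \<Rightarrow> ('v, 'e) qpath \<Rightarrow> ('v, 'e) qpath \<Rightarrow>\<^sub>0 'k::field" where
  "path_mult (u, p, v) (u', p', v') =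
     (if v = u' then Poly_Mapping.single (u, p @ p', v') 1 else 0)"

definition path_algebra ::
  "('v, 'e) pre_digraph \<Rightarrow> ('k::field, ('v, 'e) qpath \<Rightarrow>\<^sub>0 'k) module" where
  "path_algebra Q =
     \<lparr>carrier = {f. Poly_Mapping.keys f \<subseteq> qpaths Q},
      monoid.mult = (\<lambda>f g. \<Sum>p\<in>Poly_Mapping.keys f. \<Sum>q\<in>Poly_Mapping.keys g.
        Poly_Mapping.map ((*) (Poly_Mapping.lookup f p * Poly_Mapping.lookup g q))
          (path_mult p q)),
      one = (\<Sum>v\<in>verts Q. Poly_Mapping.single (v, [], v) 1),
      zero = 0,
      add = (+),
      module.smult = (\<lambda>c. Poly_Mapping.map ((*) c))\<rparr>"

definition arrow_ideal :: "('v, 'e) pre_digraph \<Rightarrow> (('v, 'e) qpath \<Rightarrow>\<^sub>0 'k::field) set" where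
  "arrow_ideal Q =
     Idl\<^bsub>path_algebra Q\<^esub> ((\<lambda>a. Poly_Mapping.single (tail Q a, [a], head Q a) 1) ` arcs Q)"

definition admissible_ideal ::
  "('v, 'e) pre_digraph \<Rightarrow> (('v, 'e) qpath \<Rightarrow>\<^sub>0 'k::field) set \<Rightarrow> bool" where
  "admissible_ideal Q I \<longleftrightarrow> ideal I (path_algebra Q) \<and>
     (\<exists>m::nat. m \<ge> 2 \<and>
        arrow_ideal Q [^]\<^bsub>ideals_set (path_algebra Q)\<^esub> m \<subseteq> I \<and>
        I \<subseteq> arrow_ideal Q [^]\<^bsub>ideals_set (path_algebra Q)\<^esub> (2::nat))"

definition admissible_presentation ::
  "('k::field \<Rightarrow> 'a::ring_1 \<Rightarrow> 'a) \<Rightarrow> 'a set \<Rightarrow> ('v, 'e) pre_digraph \<Rightarrow>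
    ((('v, 'e) qpath \<Rightarrow>\<^sub>0 'k) \<Rightarrow> 'a) \<Rightarrow> bool" where
  "admissible_presentation scale S Q \<nu> \<longleftrightarrow>
     \<nu> \<in> ring_hom (path_algebra Q) (ring_on S) \<and>
     (\<forall>c. \<forall>f\<in>carrier (path_algebra Q). \<nu> (c \<odot>\<^bsub>path_algebra Q\<^esub> f) = scale c (\<nu> f)) \<and>
     \<nu> ` carrier (path_algebra Q) = S \<and>
     admissible_ideal Q (a_kernel (path_algebra Q) (ring_on S) \<nu>)"


section \<open>Lie algebras\<close>

text \<open>The multiplication field of the module record carries the Lie bracket; its field for the
  multiplicative unit is not used.\<close>

locale lie_algebra = field K + Module.module K L
  for K :: "('k, 'm) ring_scheme" (structure) and L :: "('k, 'g, 'n) module_scheme" (structure) +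
  assumes bracket_closed:
      "\<lbrakk>x \<in> carrier L; y \<in> carrier L\<rbrakk> \<Longrightarrow> x \<otimes>\<^bsub>L\<^esub> y \<in> carrier L"
    and bracket_add_left:
      "\<lbrakk>x \<in> carrier L; y \<in> carrier L; z \<in> carrier L\<rbrakk> \<Longrightarrow>
        (x \<oplus>\<^bsub>L\<^esub> y) \<otimes>\<^bsub>L\<^esub> z = (x \<otimes>\<^bsub>L\<^esub> z) \<oplus>\<^bsub>L\<^esub> (y \<otimes>\<^bsub>L\<^esub> z)"
    and bracket_add_right:
      "\<lbrakk>x \<in> carrier L; y \<in> carrier L; z \<in> carrier L\<rbrakk> \<Longrightarrow>
        z \<otimes>\<^bsub>L\<^esub> (x \<oplus>\<^bsub>L\<^esub> y) = (z \<otimes>\<^bsub>L\<^esub> x) \<oplus>\<^bsub>L\<^esub> (z \<otimes>\<^bsub>L\<^esub> y)"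
    and bracket_smult_left:
      "\<lbrakk>c \<in> carrier K; x \<in> carrier L; y \<in> carrier L\<rbrakk> \<Longrightarrow>
        (c \<odot>\<^bsub>L\<^esub> x) \<otimes>\<^bsub>L\<^esub> y = c \<odot>\<^bsub>L\<^esub> (x \<otimes>\<^bsub>L\<^esub> y)"
    and bracket_smult_right:
      "\<lbrakk>c \<in> carrier K; x \<in> carrier L; y \<in> carrier L\<rbrakk> \<Longrightarrow>
        x \<otimes>\<^bsub>L\<^esub> (c \<odot>\<^bsub>L\<^esub> y) = c \<odot>\<^bsub>L\<^esub> (x \<otimes>\<^bsub>L\<^esub> y)"
    and bracket_self: "x \<in> carrier L \<Longrightarrow> x \<otimes>\<^bsub>L\<^esub> x = \<zero>\<^bsub>L\<^esub>"
    and jacobi: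
      "\<lbrakk>x \<in> carrier L; y \<in> carrier L; z \<in> carrier L\<rbrakk> \<Longrightarrow>
        (x \<otimes>\<^bsub>L\<^esub> (y \<otimes>\<^bsub>L\<^esub> z)) \<oplus>\<^bsub>L\<^esub> (y \<otimes>\<^bsub>L\<^esub> (z \<otimes>\<^bsub>L\<^esub> x)) \<oplus>\<^bsub>L\<^esub>
          (z \<otimes>\<^bsub>L\<^esub> (x \<otimes>\<^bsub>L\<^esub> y)) = \<zero>\<^bsub>L\<^esub>"

definition lie_product ::
  "('k, 'm) ring_scheme \<Rightarrow> ('k, 'g, 'n) module_scheme \<Rightarrow> 'g set \<Rightarrow> 'g set \<Rightarrow> 'g set" where
  "lie_product K L X Y =
     \<Inter>{N. submodule N K L \<and> {x \<otimes>\<^bsub>L\<^esub> y |x y. x \<in> X \<and> y \<in> Y} \<subseteq> N}"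

primrec lower_central_series ::
  "('k, 'm) ring_scheme \<Rightarrow> ('k, 'g, 'n) module_scheme \<Rightarrow> nat \<Rightarrow> 'g set" where
  "lower_central_series K L 0 = carrier L"
| "lower_central_series K L (Suc n) = lie_product K L (carrier L) (lower_central_series K L n)"

definition nilpotent_lie_algebra ::
  "('k, 'm) ring_scheme \<Rightarrow> ('k, 'g, 'n) module_scheme \<Rightarrow> bool" where
  "nilpotent_lie_algebra K L \<longleftrightarrow>
     lie_algebra K L \<and> (\<exists>n. lower_central_series K L n = {\<zero>\<^bsub>L\<^esub>})"

definition strongly_solvable_lie_algebra ::
  "('k, 'm) ring_scheme \<Rightarrow> ('k, 'g, 'n) module_scheme \<Rightarrow> bool" where
  "strongly_solvable_lie_algebra K L \<longleftrightarrow> lie_algebra K L \<and>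
     nilpotent_lie_algebra K (L\<lparr>carrier := lie_product K L (carrier L) (carrier L)\<rparr>)"

text \<open>The library quotient of (not necessarily associative) ring records induces addition and
  bracket on cosets; it is extended by the scalar multiplication, where adding \<open>I\<close> makes
  \<open>0\<close> times a coset equal to \<open>I\<close> rather than to a singleton.\<close>

definition lie_quotient ::
  "('k, 'g, 'n) module_scheme \<Rightarrow> 'g set \<Rightarrow> ('k, 'g set) module" where
  "lie_quotient L I =
     ring.extend (L Quot I) (module.fields (\<lambda>c X. \<Union>x\<in>X. I +>\<^bsub>L\<^esub> (c \<odot>\<^bsub>L\<^esub> x)))"


section \<open>Relative first Hochschild cohomology\<close>

definition derivation :: "('k::field \<Rightarrow> 'a::ring_1 \<Rightarrow> 'a) \<Rightarrow> ('a \<Rightarrow> 'a) \<Rightarrow> bool" where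
  "derivation scale D \<longleftrightarrow>
     Vector_Spaces.linear scale scale D \<and> (\<forall>x y. D (x * y) = D x * y + x * D y)"

definition inner_derivation :: "('a::ring_1 \<Rightarrow> 'a) \<Rightarrow> bool" where
  "inner_derivation D \<longleftrightarrow> (\<exists>c. D = (\<lambda>x. c * x - x * c))"

definition bimodule_hom :: "'a::ring_1 set \<Rightarrow> ('a \<Rightarrow> 'a) \<Rightarrow> bool" where
  "bimodule_hom B D \<longleftrightarrow> (\<forall>x y. D (x + y) = D x + D y) \<and>
     (\<forall>b\<in>B. \<forall>x. D (b * x) = b * D x \<and> D (x * b) = D x * b)"

definition rel_Der :: "('k::field \<Rightarrow> 'a::ring_1 \<Rightarrow> 'a) \<Rightarrow> 'a set \<Rightarrow> ('k, 'a \<Rightarrow> 'a) module" where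
  "rel_Der scale B =
     \<lparr>carrier = {D. derivation scale D \<and> bimodule_hom B D},
      monoid.mult = (\<lambda>D E x. D (E x) - E (D x)),
      one = undefined,
      zero = (\<lambda>x. 0),
      add = (\<lambda>D E x. D x + E x),
      module.smult = (\<lambda>c D x. scale c (D x))\<rparr>"

definition rel_Inn :: "'a::ring_1 set \<Rightarrow> ('a \<Rightarrow> 'a) set" where
  "rel_Inn B = {D. inner_derivation D \<and> bimodule_hom B D}"

definition rel_HH1 ::
  "('k::field \<Rightarrow> 'a::ring_1 \<Rightarrow> 'a) \<Rightarrow> 'a set \<Rightarrow> ('k, ('a \<Rightarrow> 'a) set) module" where
  "rel_HH1 scale B = lie_quotient (rel_Der scale B) (rel_Inn B)"

end

theory Submission
  imports Defs
begin

text \<open>Give every arrow of \<open>Q\<^sub>B\<close> weight \<open>3\<close> and every other arrow of \<open>Q\<^sub>A\<close> weight \<open>2\<close>, and let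
  \<open>F\<^sub>n\<close> be the span of the images in \<open>A\<close> of the paths of weight at least \<open>n\<close>. This is a
  multiplicative filtration which vanishes eventually. A derivation \<open>D\<close> vanishing on \<open>B\<close>
  kills the vertices and the arrows of \<open>Q\<^sub>B\<close>. An arrow \<open>a\<close> of \<open>Q\<^sub>C\<close> is mapped into the span of the
  paths parallel to it, so \<open>D a \<in> k a + F\<^sub>3\<close>, because \<open>Q\<^sub>A\<close> has no loops and
  \<open>Q\<^sub>C\<close> has no parallel arrows. Hence \<open>D\<close> preserves the filtration, and the scalars cancel in the
  commutator of two such derivations, which therefore maps \<open>F\<^sub>n\<close> to \<open>F\<^sub>n\<^sub>+\<^sub>1\<close>. An \<open>n\<close>-fold
  nested commutator of elements of the derived algebra raises the filtration degree by at least
  \<open>n\<close>, so it is zero for large \<open>n\<close>.\<close>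

section \<open>Lie algebras with a filtration, and their quotients\<close>

lemma submodule_zero_closed: "submodule N K L \<Longrightarrow> \<zero>\<^bsub>L\<^esub> \<in> N"
  using subgroup.one_closed[of N "add_monoid L"] by (simp add: submodule_def)

text \<open>The axioms are identities, plus the existence of negatives, so they pass along any
  surjection \<open>h\<close> compatible with the operations. The intended \<open>h\<close> is the
  coset map, whose target is not yet known to be even a group.\<close>

lemma lie_algebra_surj_image:
  assumes L: "lie_algebra K L"
    and carrier: "carrier H = h ` carrier L"
    and zero: "\<zero>\<^bsub>H\<^esub> = h \<zero>\<^bsub>L\<^esub>"
    and add: "\<And>x y. \<lbrakk>x \<in> carrier L; y \<in> carrier L\<rbrakk> \<Longrightarrow> h x \<oplus>\<^bsub>H\<^esub> h y = h (x \<oplus>\<^bsub>L\<^esub> y)"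
    and smult: "\<And>c x. \<lbrakk>c \<in> carrier K; x \<in> carrier L\<rbrakk> \<Longrightarrow> c \<odot>\<^bsub>H\<^esub> h x = h (c \<odot>\<^bsub>L\<^esub> x)"
    and bracket: "\<And>x y. \<lbrakk>x \<in> carrier L; y \<in> carrier L\<rbrakk> \<Longrightarrow> h x \<otimes>\<^bsub>H\<^esub> h y = h (x \<otimes>\<^bsub>L\<^esub> y)"
  shows "lie_algebra K H"
proof -
  interpret L: lie_algebra K L by fact
  have "abelian_group H"
  proof (rule abelian_groupI)
    fix x assume "x \<in> carrier H"
    then obtain x' where x': "x' \<in> carrier L" "x = h x'" using carrier by auto
    have "h (\<ominus>\<^bsub>L\<^esub> x') \<in> carrier H" "h (\<ominus>\<^bsub>L\<^esub> x') \<oplus>\<^bsub>H\<^esub> x = \<zero>\<^bsub>H\<^esub>"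
      using x' by (auto simp: carrier zero add L.M.l_neg)
    then show "\<exists>y\<in>carrier H. y \<oplus>\<^bsub>H\<^esub> x = \<zero>\<^bsub>H\<^esub>" by blast
  qed (auto simp: carrier zero add L.M.a_assoc L.M.a_comm L.M.a_lcomm)
  then have "Module.module K H"
    by (intro moduleI L.cring_axioms)
      (auto simp: carrier smult add L.smult_l_distr L.smult_r_distr L.smult_assoc1)
  moreover have "lie_algebra_axioms K H"
    by unfold_locales
      (auto simp: carrier zero smult add bracket L.bracket_closed L.bracket_add_left
        L.bracket_add_right L.bracket_smult_left L.bracket_smult_right L.bracket_self L.jacobi)
  ultimately show ?thesis
    by (simp add: lie_algebra_def L.field_axioms)
qed

lemma lie_subalgebra:
  assumes L: "lie_algebra K L" and M: "submodule M K L"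
    and closed: "\<And>x y. \<lbrakk>x \<in> M; y \<in> M\<rbrakk> \<Longrightarrow> x \<otimes>\<^bsub>L\<^esub> y \<in> M"
  shows "lie_algebra K (L\<lparr>carrier := M\<rparr>)"
proof -
  interpret L: lie_algebra K L by fact
  have sub: "M \<subseteq> carrier L" using L.submoduleE(1)[OF M] .
  then have "lie_algebra_axioms K (L\<lparr>carrier := M\<rparr>)"
    by unfold_locales
      (auto simp: subset_iff closed L.bracket_closed L.bracket_add_left
        L.bracket_add_right L.bracket_smult_left L.bracket_smult_right L.bracket_self L.jacobi)
  moreover have "Module.module K (L\<lparr>carrier := M\<rparr>)"
    using submodule.submodule_is_module[OF M] L.module_axioms by blast
  ultimately show ?thesis
    by (simp add: lie_algebra_def L.field_axioms)
qed

lemma submodule_carrier_update: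
  assumes L: "Module.module K L" and M: "submodule M K L" and N: "submodule N K L" and "N \<subseteq> M"
  shows "submodule N K (L\<lparr>carrier := M\<rparr>)"
proof -
  interpret M: Module.module K "L\<lparr>carrier := M\<rparr>"
    by (rule submodule.submodule_is_module[OF M L])
  show ?thesis
    using M.module_incl_imp_submodule[of N] submodule.submodule_is_module[OF N L] \<open>N \<subseteq> M\<close> by simp
qed

context Module.module
begin

lemma submodule_if_closed:
  assumes "H \<subseteq> carrier M" and "\<zero>\<^bsub>M\<^esub> \<in> H"
    and "\<And>x y. \<lbrakk>x \<in> H; y \<in> H\<rbrakk> \<Longrightarrow> x \<oplus>\<^bsub>M\<^esub> y \<in> H"
    and smult: "\<And>a x. \<lbrakk>a \<in> carrier R; x \<in> H\<rbrakk> \<Longrightarrow> a \<odot>\<^bsub>M\<^esub> x \<in> H"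
  shows "submodule H R M"
proof (rule submoduleI)
  show "\<ominus>\<^bsub>M\<^esub> x \<in> H" if "x \<in> H" for x
    \<comment> \<open>Negatives are obtained by scaling with minus one.\<close>
    using smult[of "\<ominus> \<one>" x] smult_l_minus[of \<one> x] that assms(1) by auto
qed (use assms in auto)

lemma submodule_Inter:
  assumes "\<N> \<noteq> {}" and N: "\<And>N. N \<in> \<N> \<Longrightarrow> submodule N R M"
  shows "submodule (\<Inter>\<N>) R M"
proof (rule submodule_if_closed)
  show "\<Inter>\<N> \<subseteq> carrier M" using assms submoduleE(1) by blast
qed (auto intro: N submodule_zero_closed submoduleE(4,5)[OF N])

end

section \<open>Strong solvability from a filtration\<close>

context lie_algebra
begin

text \<open>The family intersected in \<open>lie_product\<close> is nonempty, since the whole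
  carrier belongs to it.\<close>

lemma submodule_lie_product: "submodule (lie_product K L X Y) K L" if "X \<subseteq> carrier L" "Y \<subseteq> carrier L"
  unfolding lie_product_def
  by (rule submodule_Inter) (use carrier_is_submodule bracket_closed that in blast)+

lemma lie_product_subset:
  assumes "submodule N K L" and "\<And>x y. \<lbrakk>x \<in> X; y \<in> Y\<rbrakk> \<Longrightarrow> x \<otimes>\<^bsub>L\<^esub> y \<in> N"
  shows "lie_product K L X Y \<subseteq> N"
  using assms unfolding lie_product_def by blast

lemma bracket_in_lie_product: "x \<in> X \<Longrightarrow> y \<in> Y \<Longrightarrow> x \<otimes>\<^bsub>L\<^esub> y \<in> lie_product K L X Y"
  unfolding lie_product_def by blast

lemma submodule_lower_central_series: "submodule (lower_central_series K L n) K L"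
proof (induction n)
  case 0
  show ?case using carrier_is_submodule by simp
next
  case (Suc n)
  then show ?case using submodule_lie_product[of "carrier L"] submoduleE(1) by simp
qed

text \<open>The derived algebra lies in \<open>G 1\<close>, so each further bracket with one of its
  elements raises the index by at least one. Term \<open>n\<close> of its lower central series
  therefore lies in \<open>G (Suc n)\<close>.\<close>

lemma strongly_solvable_if_filtration:
  assumes G: "\<And>n. submodule (G n) K L"
    and bracket_0: "\<And>x y. \<lbrakk>x \<in> carrier L; y \<in> carrier L\<rbrakk> \<Longrightarrow> x \<otimes>\<^bsub>L\<^esub> y \<in> G 1"
    and bracket: "\<And>m n x y. \<lbrakk>x \<in> G m; y \<in> G n\<rbrakk> \<Longrightarrow> x \<otimes>\<^bsub>L\<^esub> y \<in> G (m + n)"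
    and zero: "G (Suc N) = {\<zero>\<^bsub>L\<^esub>}"
  shows "strongly_solvable_lie_algebra K L"
proof -
  define L' where "L' = L\<lparr>carrier := lie_product K L (carrier L) (carrier L)\<rparr>"
  have carrier': "submodule (carrier L') K L"
    using submodule_lie_product by (simp add: L'_def)
  have sub: "carrier L' \<subseteq> carrier L" using submoduleE(1)[OF carrier'] .
  have "lie_algebra K L'"
    unfolding L'_def
    by (rule lie_subalgebra[OF lie_algebra_axioms])
      (use carrier' sub bracket_in_lie_product[of _ "carrier L"] in \<open>auto simp: L'_def subset_iff\<close>)
  then interpret L': lie_algebra K L' .
  have G1: "carrier L' \<subseteq> G 1"
    using lie_product_subset[OF G bracket_0] by (simp add: L'_def)
  have "lower_central_series K L' n \<subseteq> G (Suc n)" for n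
  proof (induction n)
    case 0
    then show ?case using G1 by simp
  next
    case (Suc n)
    \<comment> \<open>The product formed in \<open>L'\<close> is the least submodule of
      \<open>L'\<close>, not of \<open>L\<close>, so the bound has to be cut down to the derived
      algebra first.\<close>
    have "submodule (\<Inter>{G (Suc (Suc n)), carrier L'}) K L"
      by (rule submodule_Inter) (use G carrier' in auto)
    then have "submodule (G (Suc (Suc n)) \<inter> carrier L') K L'"
      using submodule_carrier_update[OF module_axioms carrier'] by (simp add: L'_def)
    moreover have "x \<otimes>\<^bsub>L'\<^esub> y \<in> G (Suc (Suc n)) \<inter> carrier L'"
      if "x \<in> carrier L'" "y \<in> lower_central_series K L' n" for x y
    proof -
      have "y \<in> carrier L'"
        using that L'.submoduleE(1)[OF L'.submodule_lower_central_series] by blast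
      moreover have "x \<otimes>\<^bsub>L\<^esub> y \<in> G (1 + Suc n)" using that Suc G1 bracket by blast
      ultimately show ?thesis using that L'.bracket_closed by (simp add: L'_def)
    qed
    ultimately have "lower_central_series K L' (Suc n) \<subseteq> G (Suc (Suc n)) \<inter> carrier L'"
      unfolding lower_central_series.simps by (rule L'.lie_product_subset)
    then show ?case by blast
  qed
  from this[of N] have "lower_central_series K L' N \<subseteq> {\<zero>\<^bsub>L'\<^esub>}"
    using zero by (simp add: L'_def)
  moreover have "\<zero>\<^bsub>L'\<^esub> \<in> lower_central_series K L' N"
    using L'.submodule_lower_central_series[of N] by (rule submodule_zero_closed)
  ultimately have "lower_central_series K L' N = {\<zero>\<^bsub>L'\<^esub>}" by blast
  then show ?thesis
    unfolding strongly_solvable_lie_algebra_def nilpotent_lie_algebra_def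
    using lie_algebra_axioms L'.lie_algebra_axioms L'_def by auto
qed

end

lemma lie_quotient_simps:
  "carrier (lie_quotient L I) = a_rcosets\<^bsub>L\<^esub> I"
  "x \<otimes>\<^bsub>lie_quotient L I\<^esub> y = rcoset_mult L I x y"
  "\<zero>\<^bsub>lie_quotient L I\<^esub> = I"
  "x \<oplus>\<^bsub>lie_quotient L I\<^esub> y = x <+>\<^bsub>L\<^esub> y"
  "c \<odot>\<^bsub>lie_quotient L I\<^esub> X = (\<Union>x\<in>X. I +>\<^bsub>L\<^esub> (c \<odot>\<^bsub>L\<^esub> x))"
  by (simp_all add: lie_quotient_def FactRing_def ring.extend_def module.fields_def)

section \<open>Quotients by Lie ideals\<close>

locale lie_ideal = lie_algebra K L + submodule I K L for I and K (structure) and L (structure) +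
  assumes bracket_ideal: "\<lbrakk>x \<in> carrier L; y \<in> I\<rbrakk> \<Longrightarrow> x \<otimes>\<^bsub>L\<^esub> y \<in> I"
begin

lemma abelian_subgroup_ideal: "abelian_subgroup I L"
  using M.abelian_group_axioms subgroup_axioms
  by (simp add: abelian_subgroupI3 additive_subgroup_def)

sublocale ideal: abelian_subgroup I L
  by (rule abelian_subgroup_ideal)

lemma coset_eqI:
  assumes "x \<in> carrier L" "y \<in> carrier L" "z \<in> I" "y = z \<oplus>\<^bsub>L\<^esub> x"
  shows "I +>\<^bsub>L\<^esub> y = I +>\<^bsub>L\<^esub> x"
proof -
  have "y \<in> I +>\<^bsub>L\<^esub> x" using assms by (auto simp: a_r_coset_def')
  then show ?thesis using ideal.a_repr_independence' assms by metis
qed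

lemma in_cosetE:
  assumes "y \<in> I +>\<^bsub>L\<^esub> x" and "x \<in> carrier L"
  obtains z where "z \<in> I" "z \<in> carrier L" "y \<in> carrier L" "y = z \<oplus>\<^bsub>L\<^esub> x"
  using assms by (auto simp: a_r_coset_def')

text \<open>The ideal axiom is one-sided. Expanding the bracket of \<open>x + y\<close> with itself
  gives antisymmetry, which supplies the other side.\<close>

lemma bracket_ideal_left:
  assumes "x \<in> I" "y \<in> carrier L"
  shows "x \<otimes>\<^bsub>L\<^esub> y \<in> I"
proof -
  have x: "x \<in> carrier L" using assms by auto
  have "(x \<oplus>\<^bsub>L\<^esub> y) \<otimes>\<^bsub>L\<^esub> (x \<oplus>\<^bsub>L\<^esub> y) = x \<otimes>\<^bsub>L\<^esub> y \<oplus>\<^bsub>L\<^esub> y \<otimes>\<^bsub>L\<^esub> x"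
    using x assms(2)
    by (simp add: bracket_add_left bracket_add_right bracket_self[of x] bracket_self[of y]
        bracket_closed M.a_comm)
  then have "x \<otimes>\<^bsub>L\<^esub> y \<oplus>\<^bsub>L\<^esub> y \<otimes>\<^bsub>L\<^esub> x = \<zero>\<^bsub>L\<^esub>"
    using x assms(2) bracket_self by simp
  then have "x \<otimes>\<^bsub>L\<^esub> y = \<ominus>\<^bsub>L\<^esub> (y \<otimes>\<^bsub>L\<^esub> x)"
    using x assms by (simp add: bracket_closed M.minus_equality)
  then show ?thesis
    using bracket_ideal[OF assms(2,1)] ideal.a_inv_closed by simp
qed

text \<open>\<open>rcoset_mult\<close> is the union of the cosets of all products of
  representatives. It collapses to one coset because changing representatives alters the bracket
  only by an element of \<open>I\<close>.\<close>

lemma rcoset_bracket: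
  assumes x: "x \<in> carrier L" and y: "y \<in> carrier L"
  shows "rcoset_mult L I (I +>\<^bsub>L\<^esub> x) (I +>\<^bsub>L\<^esub> y) = I +>\<^bsub>L\<^esub> (x \<otimes>\<^bsub>L\<^esub> y)"
proof -
  have "I +>\<^bsub>L\<^esub> (a \<otimes>\<^bsub>L\<^esub> b) = I +>\<^bsub>L\<^esub> (x \<otimes>\<^bsub>L\<^esub> y)"
    if a: "a \<in> I +>\<^bsub>L\<^esub> x" and b: "b \<in> I +>\<^bsub>L\<^esub> y" for a b
  proof -
    obtain i where i: "i \<in> I" "i \<in> carrier L" "a = i \<oplus>\<^bsub>L\<^esub> x"
      using in_cosetE[OF a x] by metis
    obtain j where j: "j \<in> I" "j \<in> carrier L" "b \<in> carrier L" "b = j \<oplus>\<^bsub>L\<^esub> y"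
      using in_cosetE[OF b y] by metis
    have "a \<otimes>\<^bsub>L\<^esub> b = (i \<otimes>\<^bsub>L\<^esub> b \<oplus>\<^bsub>L\<^esub> x \<otimes>\<^bsub>L\<^esub> j) \<oplus>\<^bsub>L\<^esub> x \<otimes>\<^bsub>L\<^esub> y"
      using i j x y
      by (simp add: bracket_add_left bracket_add_right bracket_closed M.a_ac)
    moreover have "i \<otimes>\<^bsub>L\<^esub> b \<oplus>\<^bsub>L\<^esub> x \<otimes>\<^bsub>L\<^esub> j \<in> I"
      using i j x bracket_ideal bracket_ideal_left by blast
    ultimately show ?thesis
      using x y i j by (intro coset_eqI) (auto simp: bracket_closed)
  qed
  moreover have "x \<in> I +>\<^bsub>L\<^esub> x" "y \<in> I +>\<^bsub>L\<^esub> y" using x y ideal.a_rcos_self by auto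
  ultimately show ?thesis unfolding rcoset_mult_def by blast
qed

lemma rcoset_smult:
  assumes c: "c \<in> carrier K" and x: "x \<in> carrier L"
  shows "(\<Union>y\<in>I +>\<^bsub>L\<^esub> x. I +>\<^bsub>L\<^esub> (c \<odot>\<^bsub>L\<^esub> y)) = I +>\<^bsub>L\<^esub> (c \<odot>\<^bsub>L\<^esub> x)"
proof -
  have "I +>\<^bsub>L\<^esub> (c \<odot>\<^bsub>L\<^esub> y) = I +>\<^bsub>L\<^esub> (c \<odot>\<^bsub>L\<^esub> x)" if y: "y \<in> I +>\<^bsub>L\<^esub> x" for y
  proof -
    obtain i where i: "i \<in> I" "i \<in> carrier L" "y = i \<oplus>\<^bsub>L\<^esub> x"
      using in_cosetE[OF y x] by metis
    then show ?thesis
      using c x by (intro coset_eqI[where z = "c \<odot>\<^bsub>L\<^esub> i"]) (auto simp: smult_r_distr)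
  qed
  moreover have "x \<in> I +>\<^bsub>L\<^esub> x" using x ideal.a_rcos_self by auto
  ultimately show ?thesis by blast
qed

text \<open>These are the hypotheses of \<open>lie_algebra_surj_image\<close> for the coset map, in
  the same order.\<close>

lemma lie_quotient_hom:
  shows "carrier (lie_quotient L I) = (\<lambda>x. I +>\<^bsub>L\<^esub> x) ` carrier L"
    and "\<zero>\<^bsub>lie_quotient L I\<^esub> = I +>\<^bsub>L\<^esub> \<zero>\<^bsub>L\<^esub>"
    and "\<lbrakk>x \<in> carrier L; y \<in> carrier L\<rbrakk> \<Longrightarrow>
      (I +>\<^bsub>L\<^esub> x) \<oplus>\<^bsub>lie_quotient L I\<^esub> (I +>\<^bsub>L\<^esub> y) = I +>\<^bsub>L\<^esub> (x \<oplus>\<^bsub>L\<^esub> y)"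
    and "\<lbrakk>c \<in> carrier K; x \<in> carrier L\<rbrakk> \<Longrightarrow>
      c \<odot>\<^bsub>lie_quotient L I\<^esub> (I +>\<^bsub>L\<^esub> x) = I +>\<^bsub>L\<^esub> (c \<odot>\<^bsub>L\<^esub> x)"
    and "\<lbrakk>x \<in> carrier L; y \<in> carrier L\<rbrakk> \<Longrightarrow>
      (I +>\<^bsub>L\<^esub> x) \<otimes>\<^bsub>lie_quotient L I\<^esub> (I +>\<^bsub>L\<^esub> y) = I +>\<^bsub>L\<^esub> (x \<otimes>\<^bsub>L\<^esub> y)"
  by (auto simp: lie_quotient_simps A_RCOSETS_def' rcoset_bracket rcoset_smult ideal.a_rcos_sum)
    (use M.a_coset_add_zero ideal.a_subset in \<open>auto simp: a_r_coset_def'\<close>)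

lemma lie_algebra_lie_quotient: "lie_algebra K (lie_quotient L I)"
  by (rule lie_algebra_surj_image[OF lie_algebra_axioms lie_quotient_hom])

lemma submodule_quotient_image:
  assumes N: "submodule N K L"
  shows "submodule ((\<lambda>x. I +>\<^bsub>L\<^esub> x) ` N) K (lie_quotient L I)"
proof -
  interpret Q: lie_algebra K "lie_quotient L I" by (rule lie_algebra_lie_quotient)
  note N' = submoduleE[OF N]
  have subset: "N \<subseteq> carrier L" using N' by blast
  have zero: "\<zero>\<^bsub>L\<^esub> \<in> N" using N submodule_zero_closed by blast
  have "\<zero>\<^bsub>lie_quotient L I\<^esub> \<in> (\<lambda>x. I +>\<^bsub>L\<^esub> x) ` N"
    unfolding lie_quotient_hom(2) using zero by (rule imageI)
  then show ?thesis
    by (rule Q.submodule_if_closed[rotated])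
      (use N' subset in \<open>auto simp: lie_quotient_hom(1,3,4) subset_iff\<close>)
qed

text \<open>The images of the \<open>G n\<close> under the coset map form a filtration of the
  quotient with the same bracket relations.\<close>

lemma strongly_solvable_lie_quotient:
  assumes G: "\<And>n. submodule (G n) K L"
    and bracket_0: "\<And>x y. \<lbrakk>x \<in> carrier L; y \<in> carrier L\<rbrakk> \<Longrightarrow> x \<otimes>\<^bsub>L\<^esub> y \<in> G 1"
    and bracket: "\<And>m n x y. \<lbrakk>x \<in> G m; y \<in> G n\<rbrakk> \<Longrightarrow> x \<otimes>\<^bsub>L\<^esub> y \<in> G (m + n)"
    and zero: "G (Suc N) = {\<zero>\<^bsub>L\<^esub>}"
  shows "strongly_solvable_lie_algebra K (lie_quotient L I)"
proof -
  interpret Q: lie_algebra K "lie_quotient L I" by (rule lie_algebra_lie_quotient)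
  have subset: "G n \<subseteq> carrier L" for n using submoduleE(1)[OF G] .
  show ?thesis
  proof (rule Q.strongly_solvable_if_filtration[where G = "\<lambda>n. (\<lambda>x. I +>\<^bsub>L\<^esub> x) ` G n" and N = N])
    show "submodule ((\<lambda>x. I +>\<^bsub>L\<^esub> x) ` G n) K (lie_quotient L I)" for n
      by (rule submodule_quotient_image[OF G])
  next
    fix x y assume "x \<in> carrier (lie_quotient L I)" "y \<in> carrier (lie_quotient L I)"
    then show "x \<otimes>\<^bsub>lie_quotient L I\<^esub> y \<in> (\<lambda>x. I +>\<^bsub>L\<^esub> x) ` G 1"
      using bracket_0 by (auto simp: lie_quotient_hom(1,5))
  next
    fix m n x y assume "x \<in> (\<lambda>x. I +>\<^bsub>L\<^esub> x) ` G m" "y \<in> (\<lambda>x. I +>\<^bsub>L\<^esub> x) ` G n"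
    then obtain a b where "a \<in> G m" "b \<in> G n" "x = I +>\<^bsub>L\<^esub> a" "y = I +>\<^bsub>L\<^esub> b" by blast
    then show "x \<otimes>\<^bsub>lie_quotient L I\<^esub> y \<in> (\<lambda>x. I +>\<^bsub>L\<^esub> x) ` G (m + n)"
      using bracket subset lie_quotient_hom(5)[of a b] by blast
  next
    show "(\<lambda>x. I +>\<^bsub>L\<^esub> x) ` G (Suc N) = {\<zero>\<^bsub>lie_quotient L I\<^esub>}"
      by (simp add: zero lie_quotient_hom(2))
  qed
qed

end

section \<open>The Lie algebra of relative derivations\<close>

lemma field_ring_on_UNIV: "Ring.field (ring_on (UNIV :: 'k::field set))"
proof -
  have "cring (ring_on (UNIV :: 'k set))"
  proof (intro cringI abelian_groupI comm_monoidI)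
    show "\<exists>y\<in>carrier (ring_on UNIV). y \<oplus>\<^bsub>ring_on UNIV\<^esub> x = \<zero>\<^bsub>ring_on UNIV\<^esub>" for x :: 'k
      by (rule bexI[of _ "- x"]) (auto simp: ring_on_def)
  qed (auto simp: ring_on_def algebra_simps)
  then show ?thesis
  proof (rule cring.cring_fieldI2)
    show "\<exists>b\<in>carrier (ring_on UNIV). a \<otimes>\<^bsub>ring_on UNIV\<^esub> b = \<one>\<^bsub>ring_on UNIV\<^esub>"
      if "a \<noteq> \<zero>\<^bsub>ring_on UNIV\<^esub>" for a :: 'k
      using that by (intro bexI[of _ "inverse a"]) (auto simp: ring_on_def)
  qed (simp add: ring_on_def)
qed

context k_algebra
begin

lemma mem_rel_Der_iff:
  "D \<in> carrier (rel_Der scale B) \<longleftrightarrow>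
     (\<forall>x y. D (x + y) = D x + D y) \<and> (\<forall>c x. D (scale c x) = scale c (D x)) \<and>
     (\<forall>x y. D (x * y) = D x * y + x * D y) \<and>
     (\<forall>b\<in>B. \<forall>x. D (b * x) = b * D x \<and> D (x * b) = D x * b)"
  using vector_space_axioms
  by (auto simp: rel_Der_def derivation_def bimodule_hom_def Vector_Spaces.linear_iff)

lemma rel_Der_diff:
  assumes "D \<in> carrier (rel_Der scale B)"
  shows "D (x - y) = D x - D y" "D 0 = 0"
proof -
  interpret D: additive D using assms by unfold_locales (simp add: mem_rel_Der_iff)
  show "D (x - y) = D x - D y" "D 0 = 0" by (rule D.diff D.zero)+
qed

lemma rel_Der_simps:
  "D \<oplus>\<^bsub>rel_Der scale B\<^esub> E = (\<lambda>x. D x + E x)"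
  "D \<otimes>\<^bsub>rel_Der scale B\<^esub> E = (\<lambda>x. D (E x) - E (D x))"
  "c \<odot>\<^bsub>rel_Der scale B\<^esub> D = (\<lambda>x. scale c (D x))"
  "\<zero>\<^bsub>rel_Der scale B\<^esub> = (\<lambda>x. 0)"
  by (simp_all add: rel_Der_def)

text \<open>In the Leibniz rule for the commutator, the mixed terms \<open>D x * E y\<close> and
  \<open>E x * D y\<close> occur in both compositions and cancel.\<close>

lemma rel_Der_bracket_closed:
  assumes D: "D \<in> carrier (rel_Der scale B)" and E: "E \<in> carrier (rel_Der scale B)"
  shows "(\<lambda>x. D (E x) - E (D x)) \<in> carrier (rel_Der scale B)"
proof -
  have "D (b * x) = b * D x" "D (x * b) = D x * b" "E (b * x) = b * E x" "E (x * b) = E x * b"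
    if "b \<in> B" for b x
    using assms that unfolding mem_rel_Der_iff by blast+
  then have "\<forall>b\<in>B. \<forall>x. D (E (b * x)) - E (D (b * x)) = b * (D (E x) - E (D x)) \<and>
      D (E (x * b)) - E (D (x * b)) = (D (E x) - E (D x)) * b"
    by (simp add: right_diff_distrib left_diff_distrib)
  moreover have "D (E (x * y)) - E (D (x * y)) = (D (E x) - E (D x)) * y + x * (D (E y) - E (D y))"
    for x y
    using assms unfolding mem_rel_Der_iff by (simp add: algebra_simps)
  ultimately show ?thesis
    using assms unfolding mem_rel_Der_iff by (simp add: algebra_simps scale_right_diff_distrib)
qed

lemma lie_algebra_rel_Der: "lie_algebra (ring_on UNIV) (rel_Der scale B)"
proof -
  interpret K: Ring.field "ring_on (UNIV :: 'k set)" by (rule field_ring_on_UNIV)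
  have "abelian_group (rel_Der scale B)"
  proof (rule abelian_groupI)
    show "\<exists>E\<in>carrier (rel_Der scale B). E \<oplus>\<^bsub>rel_Der scale B\<^esub> D = \<zero>\<^bsub>rel_Der scale B\<^esub>"
      if "D \<in> carrier (rel_Der scale B)" for D
      using that by (intro bexI[of _ "\<lambda>x. - D x"]) (auto simp: rel_Der_simps mem_rel_Der_iff)
  qed (auto simp: rel_Der_simps mem_rel_Der_iff algebra_simps)
  then have "Module.module (ring_on UNIV) (rel_Der scale B)"
    by (intro moduleI K.cring_axioms)
      (auto simp: rel_Der_simps mem_rel_Der_iff ring_on_def scale_mult_left scale_mult_right
        scale_left_commute algebra_simps scale_right_distrib scale_left_distrib)
  moreover have "lie_algebra_axioms (ring_on UNIV) (rel_Der scale B)"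
    by unfold_locales
      (auto simp: rel_Der_simps rel_Der_bracket_closed rel_Der_diff,
       auto simp: mem_rel_Der_iff scale_right_diff_distrib algebra_simps)
  ultimately show ?thesis
    by (simp add: lie_algebra_def K.field_axioms)
qed

lemma inner_derivation_mem_rel_Der:
  assumes "inner_derivation D" and "bimodule_hom B D"
  shows "D \<in> carrier (rel_Der scale B)"
proof -
  obtain c where D: "D = (\<lambda>x. c * x - x * c)" using assms(1) by (auto simp: inner_derivation_def)
  have "D (scale r x) = scale r (D x)" "D (x * y) = D x * y + x * D y" for r x y
    by (simp_all add: D scale_mult_left scale_mult_right scale_right_diff_distrib algebra_simps)
  then show ?thesis
    using assms(2) by (auto simp: mem_rel_Der_iff bimodule_hom_def)
qed

lemma lie_ideal_rel_Inn: "lie_ideal (rel_Inn B) (ring_on UNIV) (rel_Der scale B)"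
proof -
  interpret L: lie_algebra "ring_on UNIV" "rel_Der scale B" by (rule lie_algebra_rel_Der)
  have mem: "D \<in> rel_Inn B \<longleftrightarrow> inner_derivation D \<and> D \<in> carrier (rel_Der scale B)" for D
    using inner_derivation_mem_rel_Der by (auto simp: rel_Inn_def rel_Der_def)
  have inner: "inner_derivation D" if "\<And>x. D x = c * x - x * c" for D and c :: 'a
    using that by (auto simp: inner_derivation_def)
  have "submodule (rel_Inn B) (ring_on UNIV) (rel_Der scale B)"
  proof (rule L.submodule_if_closed)
    show "\<zero>\<^bsub>rel_Der scale B\<^esub> \<in> rel_Inn B"
      unfolding mem by (auto simp: rel_Der_simps intro: inner[of _ 0] simp: mem_rel_Der_iff)
  next
    fix D E assume DE: "D \<in> rel_Inn B" "E \<in> rel_Inn B"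
    then obtain c d where "D = (\<lambda>x. c * x - x * c)" "E = (\<lambda>x. d * x - x * d)"
      by (auto simp: mem inner_derivation_def)
    then have "inner_derivation (D \<oplus>\<^bsub>rel_Der scale B\<^esub> E)"
      by (intro inner[of _ "c + d"]) (simp add: rel_Der_simps algebra_simps)
    then show "D \<oplus>\<^bsub>rel_Der scale B\<^esub> E \<in> rel_Inn B" using DE by (auto simp: mem)
  next
    fix r D assume r: "r \<in> carrier (ring_on (UNIV :: 'k set))" and D: "D \<in> rel_Inn B"
    then obtain c where "D = (\<lambda>x. c * x - x * c)" by (auto simp: mem inner_derivation_def)
    then have "inner_derivation (r \<odot>\<^bsub>rel_Der scale B\<^esub> D)"
      by (intro inner[of _ "scale r c"])
        (simp add: rel_Der_simps scale_mult_left scale_mult_right scale_right_diff_distrib)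
    then show "r \<odot>\<^bsub>rel_Der scale B\<^esub> D \<in> rel_Inn B" using D r by (auto simp: mem)
  qed (auto simp: mem)
  moreover have "D \<otimes>\<^bsub>rel_Der scale B\<^esub> E \<in> rel_Inn B"
    if D: "D \<in> carrier (rel_Der scale B)" and E: "E \<in> rel_Inn B" for D E
  proof -
    obtain c where "E = (\<lambda>x. c * x - x * c)" using E by (auto simp: mem inner_derivation_def)
    then have "inner_derivation (D \<otimes>\<^bsub>rel_Der scale B\<^esub> E)"
      \<comment> \<open>The commutator of \<open>D\<close> with the inner derivation given by
        \<open>c\<close> is the inner derivation given by \<open>D c\<close>.\<close>
      using D by (intro inner[of _ "D c"])
        (simp add: rel_Der_simps rel_Der_diff[OF D], simp add: mem_rel_Der_iff)
    then show ?thesis using D E L.bracket_closed by (auto simp: mem)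
  qed
  ultimately show ?thesis
    by (simp add: lie_ideal_def lie_ideal_axioms_def L.lie_algebra_axioms)
qed

end

section \<open>The weight filtration of a presented algebra\<close>

lemma lookup_map_times [simp]:
  "Poly_Mapping.lookup (Poly_Mapping.map ((*) c) f) k = (c :: 'k::mult_zero) * Poly_Mapping.lookup f k"
  by (simp add: Poly_Mapping.map.rep_eq when_def)

lemma path_algebra_simps:
  "f \<in> carrier (path_algebra Q) \<longleftrightarrow> Poly_Mapping.keys f \<subseteq> qpaths Q"
  "f \<oplus>\<^bsub>path_algebra Q\<^esub> g = f + g"
  "c \<odot>\<^bsub>path_algebra Q\<^esub> f = Poly_Mapping.map ((*) c) f"
  "\<zero>\<^bsub>path_algebra Q\<^esub> = 0"
  by (simp_all add: path_algebra_def)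

lemma path_algebra_mult_single:
  "Poly_Mapping.single p 1 \<otimes>\<^bsub>path_algebra Q\<^esub> Poly_Mapping.single q 1 = path_mult p q"
  by (auto simp: path_algebra_def intro: poly_mapping_eqI)

lemma single_mem_path_algebra:
  "pre_digraph.awalk Q u p v \<Longrightarrow> Poly_Mapping.single (u, p, v) c \<in> carrier (path_algebra Q)"
  by (simp add: path_algebra_simps qpaths_def)

text \<open>A path is the product of its arrows. The induction removes the last arrow because powers
  in the monoid of ideals gain their new factor on the right; the zeroth power is the whole path
  algebra.\<close>

lemma (in pre_digraph) single_mem_arrow_ideal_pow:
  assumes "awalk u p v"
  shows "Poly_Mapping.single (u, p, v) (1 :: 'k::field) \<in>
    arrow_ideal G [^]\<^bsub>ideals_set (path_algebra G)\<^esub> length p"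
  using assms
proof (induction p arbitrary: v rule: rev_induct)
  case Nil
  then show ?case by (simp add: nat_pow_def ideals_set_def single_mem_path_algebra)
next
  case (snoc a p)
  then have p: "awalk u p (tail G a)" and a: "a \<in> arcs G" "head G a = v"
    by (auto simp: awalk_def cas_append_iff)
  have "Poly_Mapping.single (tail G a, [a], head G a) (1 :: 'k) \<in> arrow_ideal G"
    using a by (auto simp: arrow_ideal_def genideal_def)
  from ideal_prod.prod[OF snoc.IH[OF p] this, of "path_algebra G"]
  show ?case
    by (simp add: nat_pow_def ideals_set_def path_algebra_mult_single a)
qed

lemma poly_mapping_sum_singles:
  "f = (\<Sum>k\<in>Poly_Mapping.keys f. Poly_Mapping.single k (Poly_Mapping.lookup f k))"
  by (rule poly_mapping_eqI)
    (auto simp: lookup_sum lookup_single when_def in_keys_iff)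

section \<open>Images of paths in a presented algebra\<close>

locale presented_algebra = k_algebra scale + wf_digraph Q
  for scale :: "'k::field \<Rightarrow> 'a::ring_1 \<Rightarrow> 'a" and Q :: "('v, 'e) pre_digraph" +
  fixes \<nu> :: "(('v, 'e) qpath \<Rightarrow>\<^sub>0 'k) \<Rightarrow> 'a"
  assumes presentation: "admissible_presentation scale UNIV Q \<nu>"
begin

definition path_image :: "'v \<Rightarrow> 'e list \<Rightarrow> 'v \<Rightarrow> 'a" where
  "path_image u p v = \<nu> (Poly_Mapping.single (u, p, v) 1)"

lemma nu_add:
  assumes "f \<in> carrier (path_algebra Q)" "g \<in> carrier (path_algebra Q)"
  shows "\<nu> (f + g) = \<nu> f + \<nu> g"
proof -
  have "\<nu> \<in> ring_hom (path_algebra Q) (ring_on UNIV)"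
    using presentation by (simp add: admissible_presentation_def)
  from ring_hom_add[OF this assms] show ?thesis by (simp add: path_algebra_simps ring_on_def)
qed

lemma nu_mult:
  assumes "f \<in> carrier (path_algebra Q)" "g \<in> carrier (path_algebra Q)"
  shows "\<nu> (f \<otimes>\<^bsub>path_algebra Q\<^esub> g) = \<nu> f * \<nu> g"
proof -
  have "\<nu> \<in> ring_hom (path_algebra Q) (ring_on UNIV)"
    using presentation by (simp add: admissible_presentation_def)
  from ring_hom_mult[OF this assms] show ?thesis by (simp add: ring_on_def)
qed

lemma nu_zero: "\<nu> 0 = 0"
  using nu_add[of 0 0] by (simp add: path_algebra_simps)

lemma nu_single:
  assumes "awalk u p v"
  shows "\<nu> (Poly_Mapping.single (u, p, v) c) = scale c (path_image u p v)"
proof -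
  have "\<nu> (c \<odot>\<^bsub>path_algebra Q\<^esub> Poly_Mapping.single (u, p, v) 1) = scale c (path_image u p v)"
    using presentation single_mem_path_algebra[OF assms]
    unfolding admissible_presentation_def path_image_def by blast
  then show ?thesis by (simp add: path_algebra_simps)
qed

lemma path_image_mult:
  assumes "awalk u p v" "awalk v' q w"
  shows "path_image u p v * path_image v' q w = (if v = v' then path_image u (p @ q) w else 0)"
  unfolding path_image_def
  by (subst nu_mult[symmetric])
    (use assms in \<open>auto simp: single_mem_path_algebra path_algebra_mult_single nu_zero\<close>)

lemma span_path_images: "span {path_image u p v |u p v. awalk u p v} = UNIV"
proof -
  \<comment> \<open>Membership in the carrier is carried through the induction because additivity of
    \<open>\<nu>\<close> is available only there.\<close>
  have sum: "(\<Sum>k\<in>K. Poly_Mapping.single k (c k)) \<in> carrier (path_algebra Q) \<and>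
      \<nu> (\<Sum>k\<in>K. Poly_Mapping.single k (c k)) \<in> span {path_image u p v |u p v. awalk u p v}"
    if "finite K" "K \<subseteq> qpaths Q" for K and c :: "('v, 'e) qpath \<Rightarrow> 'k"
    using that
  proof (induction K rule: finite_induct)
    case empty
    then show ?case by (simp add: nu_zero span_zero path_algebra_simps)
  next
    case (insert k K)
    obtain u p v where k: "k = (u, p, v)" "awalk u p v"
      using insert.prems by (auto simp: qpaths_def)
    let ?g = "Poly_Mapping.single k (c k)" and ?h = "\<Sum>k\<in>K. Poly_Mapping.single k (c k)"
    have g: "?g \<in> carrier (path_algebra Q)"
      using k single_mem_path_algebra by simp
    have "\<nu> ?g \<in> span {path_image u p v |u p v. awalk u p v}"
      unfolding k(1) nu_single[OF k(2)] using k(2) by (intro span_scale span_base) blast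
    moreover have "?g + ?h \<in> carrier (path_algebra Q)"
      using g insert Poly_Mapping.keys_add[of ?g ?h] unfolding path_algebra_simps by blast
    ultimately show ?case
      using insert g by (simp add: nu_add span_add)
  qed
  have "y \<in> span {path_image u p v |u p v. awalk u p v}" for y
  proof -
    have "y \<in> \<nu> ` carrier (path_algebra Q)"
      using presentation by (simp add: admissible_presentation_def)
    then obtain f where f: "f \<in> carrier (path_algebra Q)" "y = \<nu> f" by blast
    then show ?thesis
      using sum[of "Poly_Mapping.keys f" "Poly_Mapping.lookup f"] poly_mapping_sum_singles[of f]
      by (simp add: path_algebra_simps)
  qed
  then show ?thesis by blast
qed

text \<open>Admissibility puts some power \<open>m\<close> of the arrow ideal into the kernel. A
  path with at least \<open>m\<close> arrows is cut after the first \<open>m\<close>, and that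
  initial piece already maps to zero.\<close>

lemma long_path_image_zero:
  obtains m where "\<And>u p v. \<lbrakk>awalk u p v; m \<le> length p\<rbrakk> \<Longrightarrow> path_image u p v = 0"
proof -
  obtain m :: nat where m: "arrow_ideal Q [^]\<^bsub>ideals_set (path_algebra Q)\<^esub> m
      \<subseteq> a_kernel (path_algebra Q) (ring_on UNIV) \<nu>"
    using presentation by (auto simp: admissible_presentation_def admissible_ideal_def)
  have "path_image u p v = 0" if p: "awalk u p v" "m \<le> length p" for u p v
  proof -
    obtain w where w: "awalk u (take m p) w" "awalk w (drop m p) v"
      using p(1) awalk_append_iff[of u "take m p" "drop m p" v] by auto
    then have "path_image u (take m p) w = 0"
      using single_mem_arrow_ideal_pow[OF w(1)] m p(2)
      by (auto simp: path_image_def a_kernel_def' ring_on_def)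
    then show ?thesis
      using path_image_mult[OF w] by simp
  qed
  then show thesis using that by blast
qed

text \<open>Multiplying a path on both sides by trivial paths returns the path or zero. By linearity
  this extends to all of the algebra, which the paths span.\<close>

lemma idempotent_sandwich:
  assumes "u \<in> verts Q" "v \<in> verts Q"
  shows "path_image u [] u * y * path_image v [] v \<in> span {path_image u p v |p. awalk u p v}"
proof -
  let ?S = "{y. path_image u [] u * y * path_image v [] v \<in> span {path_image u p v |p. awalk u p v}}"
  have "subspace ?S"
    by (rule subspaceI)
      (auto simp: span_zero span_add distrib_left distrib_right scale_mult_left scale_mult_right span_scale)
  moreover have "path_image u' p v' \<in> ?S" if p: "awalk u' p v'" for u' p v'
    using p assms by (auto simp: path_image_mult awalk_Nil_iff span_zero intro: span_base)
  ultimately have "span {path_image u p v |u p v. awalk u p v} \<subseteq> ?S"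
    by (intro span_minimal) auto
  then show ?thesis by (auto simp: span_path_images)
qed

end

section \<open>Weight filtration and relative derivations\<close>

locale relative_presentation = presented_algebra scale Q \<nu>
  for scale :: "'k::field \<Rightarrow> 'a::ring_1 \<Rightarrow> 'a" and Q :: "('v, 'e) pre_digraph" and \<nu> +
  fixes B :: "'a set" and S :: "'e set"
  assumes loopfree: "loopfree_digraph Q"
    and vertex_mem: "u \<in> verts Q \<Longrightarrow> path_image u [] u \<in> B"
    and arrow_mem: "\<lbrakk>a \<in> arcs Q; a \<in> S\<rbrakk> \<Longrightarrow> path_image (tail Q a) [a] (head Q a) \<in> B"
    and simple: "\<lbrakk>a \<in> arcs Q - S; b \<in> arcs Q - S; tail Q a = tail Q b; head Q a = head Q b\<rbrakk> \<Longrightarrow> a = b"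
begin

text \<open>\<open>S\<close> stands for the arrows of \<open>Q\<^sub>B\<close>. The values are
  chosen so that an arrow in \<open>S\<close> and any path of length two (weight at least four) are
  both strictly heavier than an arrow outside \<open>S\<close>.\<close>

definition weight :: "'e list \<Rightarrow> nat" where
  "weight p = (\<Sum>a\<leftarrow>p. if a \<in> S then 3 else 2)"

definition filtration :: "nat \<Rightarrow> 'a set" where
  "filtration n = span {path_image u p v |u p v. awalk u p v \<and> n \<le> weight p}"

lemma weight_simps [simp]:
  "weight [] = 0" "weight (a # p) = (if a \<in> S then 3 else 2) + weight p"
  "weight (p @ q) = weight p + weight q"
  by (simp_all add: weight_def)

lemma weight_le: "weight p \<le> 3 * length p"
  by (induction p) auto

lemma weight_ge: "2 * length p \<le> weight p"
  by (induction p) auto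

lemma subspace_filtration: "subspace (filtration n)"
  by (simp add: filtration_def)

lemma path_image_mem_filtration: "\<lbrakk>awalk u p v; n \<le> weight p\<rbrakk> \<Longrightarrow> path_image u p v \<in> filtration n"
  unfolding filtration_def by (rule span_base) blast

lemma filtration_antimono: "m \<le> n \<Longrightarrow> filtration n \<subseteq> filtration m"
  unfolding filtration_def by (rule span_mono) (use le_trans in blast)

lemma filtration_0: "filtration 0 = UNIV"
  using span_path_images by (simp add: filtration_def)

text \<open>Linearity in each factor reduces the claim to two paths. Their product is zero or the
  concatenated path, whose weight is the sum.\<close>

lemma filtration_mult:
  assumes "x \<in> filtration m" "y \<in> filtration n"
  shows "x * y \<in> filtration (m + n)"
proof -
  note sub = subspace_0[OF subspace_filtration] subspace_add[OF subspace_filtration]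
    subspace_scale[OF subspace_filtration]
  have right: "path_image u p v * y \<in> filtration (m + n)" if p: "awalk u p v" "m \<le> weight p" for u p v
  proof -
    have "filtration n \<subseteq> {y. path_image u p v * y \<in> filtration (m + n)}"
      unfolding filtration_def[of n]
    proof (rule span_minimal)
      show "{path_image u p v |u p v. awalk u p v \<and> n \<le> weight p}
          \<subseteq> {y. path_image u p v * y \<in> filtration (m + n)}"
        using p by (auto simp: path_image_mult sub intro!: path_image_mem_filtration awalk_appendI)
      show "subspace {y. path_image u p v * y \<in> filtration (m + n)}"
        by (rule subspaceI) (auto simp: sub distrib_left scale_mult_right)
    qed
    then show ?thesis using assms(2) by blast
  qed
  have "filtration m \<subseteq> {x. x * y \<in> filtration (m + n)}"
    unfolding filtration_def[of m]
  proof (rule span_minimal)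
    show "subspace {x. x * y \<in> filtration (m + n)}"
      by (rule subspaceI) (auto simp: sub distrib_right scale_mult_left)
  qed (use right in auto)
  then show ?thesis using assms(1) by blast
qed

lemma filtration_eventually_zero:
  obtains N where "filtration N = {0}"
proof -
  obtain m where m: "\<And>u p v. \<lbrakk>awalk u p v; m \<le> length p\<rbrakk> \<Longrightarrow> path_image u p v = 0"
    using long_path_image_zero by blast
  \<comment> \<open>An arrow weighs at most three, so a heavy path is long and its image
    vanishes.\<close>
  have "m \<le> length p" if "3 * m \<le> weight p" for p
    using that weight_le[of p] by linarith
  then have "filtration (3 * m) \<subseteq> span {0}"
    unfolding filtration_def using m by (intro span_mono) blast
  then have "filtration (3 * m) = {0}"
    using subspace_0[OF subspace_filtration] by (auto simp: span_insert_0)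
  then show thesis by (rule that)
qed

lemma derivation_vanishes:
  assumes D: "D \<in> carrier (rel_Der scale B)" and b: "b \<in> B"
  shows "D b = 0"
proof -
  \<comment> \<open>The Leibniz rule for \<open>1 * 1\<close> gives \<open>D 1 = D 1 + D 1\<close>;
    linearity over \<open>B\<close> then yields \<open>D b = b * D 1\<close>.\<close>
  have "D 1 = 0" using D[unfolded mem_rel_Der_iff, THEN conjunct2, THEN conjunct2, THEN conjunct1, rule_format, of 1 1] by simp
  moreover have "D (b * 1) = b * D 1" using D b unfolding mem_rel_Der_iff by blast
  ultimately show ?thesis by simp
qed

text \<open>By the Leibniz rule \<open>D\<close> acts on a path one arrow at a time. Vertices and
  arrows in \<open>S\<close> are killed, so only the arrows outside \<open>S\<close>, of weight two,
  have to be controlled.\<close>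

lemma derivation_shifts_filtration:
  assumes D: "D \<in> carrier (rel_Der scale B)"
    and arrows: "\<And>a. a \<in> arcs Q - S \<Longrightarrow> D (path_image (tail Q a) [a] (head Q a)) \<in> filtration (2 + r)"
    and x: "x \<in> filtration n"
  shows "D x \<in> filtration (n + r)"
proof -
  note sub = subspace_0[OF subspace_filtration] subspace_add[OF subspace_filtration]
    subspace_scale[OF subspace_filtration]
  have D': "D (x + y) = D x + D y" "D (scale c x) = scale c (D x)" "D (x * y) = D x * y + x * D y" for x y c
    using D by (auto simp: mem_rel_Der_iff)
  have walk: "D (path_image u p v) \<in> filtration (weight p + r)" if "awalk u p v" for u p v
    using that
  proof (induction p arbitrary: u)
    case Nil
    then show ?case using derivation_vanishes[OF D vertex_mem] sub by (auto simp: awalk_Nil_iff)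
  next
    case (Cons a p)
    then have a: "a \<in> arcs Q" "u = tail Q a" "awalk u [a] (head Q a)" and p: "awalk (head Q a) p v"
      by (auto simp: awalk_Cons_iff awalk_Nil_iff)
    have "D (path_image u [a] (head Q a)) \<in> filtration (weight [a] + r)"
      using derivation_vanishes[OF D arrow_mem] arrows[of a] a sub by auto
    from filtration_mult[OF this path_image_mem_filtration[OF p order_refl]]
      filtration_mult[OF path_image_mem_filtration[OF a(3) order_refl] Cons.IH[OF p]]
    have "D (path_image u [a] (head Q a) * path_image (head Q a) p v) \<in> filtration (weight (a # p) + r)"
      unfolding D' by (intro sub) (auto simp: add_ac)
    then show ?case using path_image_mult[OF a(3) p] by simp
  qed
  have "filtration n \<subseteq> {x. D x \<in> filtration (n + r)}"
    unfolding filtration_def[of n]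
  proof (rule span_minimal)
    show "subspace {x. D x \<in> filtration (n + r)}"
      by (rule subspaceI) (auto simp: D' sub rel_Der_diff[OF D])
    show "{path_image u p v |u p v. awalk u p v \<and> n \<le> weight p} \<subseteq> {x. D x \<in> filtration (n + r)}"
      using walk filtration_antimono add_le_mono1 by blast
  qed
  then show ?thesis using x by blast
qed

text \<open>As \<open>Q\<close> has no loops, a path parallel to an arrow \<open>a\<close> outside \<open>S\<close> is \<open>a\<close> itself,
  an arrow in \<open>S\<close>, or has length at least two; in the last two cases its weight is at least three.\<close>

lemma derivation_arrow_eigenvector:
  assumes D: "D \<in> carrier (rel_Der scale B)" and a: "a \<in> arcs Q - S"
  obtains c where "D (path_image (tail Q a) [a] (head Q a)) -
    scale c (path_image (tail Q a) [a] (head Q a)) \<in> filtration 3"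
proof -
  let ?u = "tail Q a" and ?v = "head Q a"
  let ?x = "path_image ?u [a] ?v"
  note sub = subspace_0[OF subspace_filtration] subspace_add[OF subspace_filtration]
    subspace_scale[OF subspace_filtration]
  have uv: "?u \<in> verts Q" "?v \<in> verts Q" "?u \<noteq> ?v"
    using a loopfree_digraph.no_loops[OF loopfree, of a] by auto
  have walk: "awalk ?u [] ?u" "awalk ?u [a] ?v" "awalk ?v [] ?v"
    using a uv by (auto simp: awalk_Nil_iff awalk_Cons_iff)
  \<comment> \<open>The trivial paths lie in \<open>B\<close>, so \<open>D\<close> commutes with
    multiplication by them. Hence \<open>D ?x\<close> is again fixed by both idempotents and is a
    combination of paths parallel to \<open>a\<close>.\<close>
  have "?x = path_image ?u [] ?u * (?x * path_image ?v [] ?v)"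
    using path_image_mult[OF walk(2,3)] path_image_mult[OF walk(1,2)] by simp
  moreover have "D (path_image ?u [] ?u * y) = path_image ?u [] ?u * D y"
    "D (y * path_image ?v [] ?v) = D y * path_image ?v [] ?v" for y
    using D vertex_mem uv unfolding mem_rel_Der_iff by blast+
  ultimately have "D ?x = path_image ?u [] ?u * D ?x * path_image ?v [] ?v"
    by (metis mult.assoc)
  then have mem: "D ?x \<in> span {path_image ?u p ?v |p. awalk ?u p ?v}"
    using idempotent_sandwich[OF uv(1,2), of "D ?x"] by metis
  \<comment> \<open>\<open>T\<close> collects the elements congruent to a scalar multiple of
    \<open>?x\<close> modulo \<open>filtration 3\<close>; as a subspace, it need only be tested on
    single paths.\<close>
  define T where "T = {y. \<exists>c. y - scale c ?x \<in> filtration 3}"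
  have "subspace T"
  proof (rule subspaceI)
    show "0 \<in> T" unfolding T_def using sub by (auto intro!: exI[of _ 0])
  next
    fix y z assume "y \<in> T" "z \<in> T"
    then obtain c d where "y - scale c ?x \<in> filtration 3" "z - scale d ?x \<in> filtration 3"
      by (auto simp: T_def)
    from sub(2)[OF this] have "y + z - scale (c + d) ?x \<in> filtration 3"
      by (simp add: scale_left_distrib algebra_simps)
    then show "y + z \<in> T" by (auto simp: T_def)
  next
    fix r y assume "y \<in> T"
    then obtain c where "y - scale c ?x \<in> filtration 3" by (auto simp: T_def)
    from sub(3)[OF this, of r] have "scale r y - scale (r * c) ?x \<in> filtration 3"
      by (simp add: scale_right_diff_distrib)
    then show "scale r y \<in> T" by (auto simp: T_def)
  qed
  moreover have "path_image ?u p ?v \<in> T" if p: "awalk ?u p ?v" for p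
  proof (cases "p = [a]")
    case True
    then show ?thesis unfolding T_def using sub by (auto intro!: exI[of _ 1])
  next
    case False
    have "3 \<le> weight p"
    proof (cases p)
      case Nil
      then show ?thesis using p uv by (auto simp: awalk_Nil_iff)
    next
      case (Cons b q)
      show ?thesis
      proof (cases q)
        case Nil
        then have "b \<in> S" using p Cons False simple[OF _ a, of b] by (auto simp: awalk_Cons_iff awalk_Nil_iff)
        then show ?thesis using Cons by simp
      qed (use Cons weight_ge[of p] in auto)
    qed
    then show ?thesis
      using path_image_mem_filtration[OF p] by (auto simp: T_def intro!: exI[of _ 0])
  qed
  ultimately have "span {path_image ?u p ?v |p. awalk ?u p ?v} \<subseteq> T"
    by (intro span_minimal) auto
  then have "D ?x \<in> T" using mem by blast
  then show thesis using that by (auto simp: T_def)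
qed

text \<open>This is the shift \<open>r = 0\<close>: both the scalar multiple of an arrow and the
  error term lie in \<open>filtration 2\<close>.\<close>

lemma derivation_preserves_filtration:
  assumes D: "D \<in> carrier (rel_Der scale B)" and x: "x \<in> filtration n"
  shows "D x \<in> filtration n"
proof -
  have "D (path_image (tail Q a) [a] (head Q a)) \<in> filtration (2 + 0)" if a: "a \<in> arcs Q - S" for a
  proof -
    let ?x = "path_image (tail Q a) [a] (head Q a)"
    obtain c where "D ?x - scale c ?x \<in> filtration 3"
      by (rule derivation_arrow_eigenvector[OF D a])
    then have "D ?x - scale c ?x \<in> filtration 2" using filtration_antimono[of 2 3] by auto
    moreover have "?x \<in> filtration 2"
      using a by (intro path_image_mem_filtration) (auto simp: awalk_Cons_iff awalk_Nil_iff)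
    ultimately have "(D ?x - scale c ?x) + scale c ?x \<in> filtration 2"
      using subspace_add[OF subspace_filtration] subspace_scale[OF subspace_filtration] by blast
    then show ?thesis by simp
  qed
  from derivation_shifts_filtration[OF D this x] show ?thesis by simp
qed

text \<open>Modulo \<open>filtration 3\<close>, both derivations act on an arrow outside
  \<open>S\<close> by scalars, and scalars commute. The commutator is itself a relative derivation,
  so this gain of one on arrows spreads to all paths.\<close>

lemma bracket_shifts_filtration:
  assumes D: "D \<in> carrier (rel_Der scale B)" and E: "E \<in> carrier (rel_Der scale B)"
    and x: "x \<in> filtration n"
  shows "D (E x) - E (D x) \<in> filtration (n + 1)"
proof -
  have "D (E (path_image (tail Q a) [a] (head Q a))) - E (D (path_image (tail Q a) [a] (head Q a)))
      \<in> filtration (2 + 1)" if a: "a \<in> arcs Q - S" for a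
  proof -
    let ?x = "path_image (tail Q a) [a] (head Q a)"
    obtain c where c: "D ?x - scale c ?x \<in> filtration 3"
      by (rule derivation_arrow_eigenvector[OF D a])
    obtain d where d: "E ?x - scale d ?x \<in> filtration 3"
      by (rule derivation_arrow_eigenvector[OF E a])
    have "D (E ?x - scale d ?x) \<in> filtration 3" "E (D ?x - scale c ?x) \<in> filtration 3"
      using derivation_preserves_filtration D E c d by blast+
    \<comment> \<open>The difference of these two elements is the commutator applied to
      \<open>?x\<close>: the terms in \<open>D ?x\<close>, in \<open>E ?x\<close> and in
      \<open>scale (c * d) ?x\<close> cancel.\<close>
    then have "D (E ?x - scale d ?x) + scale d (D ?x - scale c ?x) \<in> filtration 3"
      "E (D ?x - scale c ?x) + scale c (E ?x - scale d ?x) \<in> filtration 3"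
      using c d subspace_add[OF subspace_filtration] subspace_scale[OF subspace_filtration] by blast+
    from subspace_diff[OF subspace_filtration this]
    have "D (E ?x - scale d ?x) + scale d (D ?x - scale c ?x) -
        (E (D ?x - scale c ?x) + scale c (E ?x - scale d ?x)) \<in> filtration 3" .
    moreover have "D (scale d ?x) = scale d (D ?x)" "E (scale c ?x) = scale c (E ?x)"
      using D E by (auto simp: mem_rel_Der_iff)
    ultimately show ?thesis
      by (simp add: rel_Der_diff[OF D] rel_Der_diff[OF E] scale_right_diff_distrib algebra_simps mult.commute
          numeral_3_eq_3)
  qed
  from derivation_shifts_filtration[OF rel_Der_bracket_closed[OF D E] this x] show ?thesis by simp
qed

text \<open>The filtration of the Lie algebra induced by that of the underlying algebra; it serves
  as \<open>G\<close> in \<open>strongly_solvable_lie_quotient\<close>.\<close>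

definition shifting_derivations :: "nat \<Rightarrow> ('a \<Rightarrow> 'a) set" where
  "shifting_derivations r =
     {D \<in> carrier (rel_Der scale B). \<forall>n. \<forall>x\<in>filtration n. D x \<in> filtration (n + r)}"

lemma strongly_solvable_rel_HH1:
  "strongly_solvable_lie_algebra (ring_on UNIV) (rel_HH1 scale B)"
proof -
  interpret lie_ideal "rel_Inn B" "ring_on UNIV" "rel_Der scale B"
    by (rule lie_ideal_rel_Inn)
  note sub = subspace_0[OF subspace_filtration] subspace_add[OF subspace_filtration]
    subspace_scale[OF subspace_filtration] subspace_diff[OF subspace_filtration]
  have closed: "\<zero>\<^bsub>rel_Der scale B\<^esub> \<in> shifting_derivations r"
    "D \<in> shifting_derivations r \<Longrightarrow> E \<in> shifting_derivations r \<Longrightarrow>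
      D \<oplus>\<^bsub>rel_Der scale B\<^esub> E \<in> shifting_derivations r"
    "D \<in> shifting_derivations r \<Longrightarrow> c \<odot>\<^bsub>rel_Der scale B\<^esub> D \<in> shifting_derivations r" for r D E c
    using M.zero_closed M.a_closed[of D E] Module.module.smult_closed[OF module_axioms, of c D]
    by (auto simp: shifting_derivations_def rel_Der_simps sub ring_on_def)
  obtain N where N: "filtration N = {0}" by (rule filtration_eventually_zero)
  show ?thesis
    unfolding rel_HH1_def
  proof (rule strongly_solvable_lie_quotient[where G = shifting_derivations and N = N])
    show "submodule (shifting_derivations r) (ring_on UNIV) (rel_Der scale B)" for r
      by (rule submodule_if_closed) (use closed in \<open>auto simp: shifting_derivations_def\<close>)
  next
    fix D E assume "D \<in> carrier (rel_Der scale B)" "E \<in> carrier (rel_Der scale B)"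
    then show "D \<otimes>\<^bsub>rel_Der scale B\<^esub> E \<in> shifting_derivations 1"
      using bracket_shifts_filtration bracket_closed
      by (simp add: shifting_derivations_def rel_Der_simps)
  next
    fix m n D E assume D: "D \<in> shifting_derivations m" and E: "E \<in> shifting_derivations n"
    have "D (E x) - E (D x) \<in> filtration (i + (m + n))" if "x \<in> filtration i" for i x
    proof (rule sub)
      show "D (E x) \<in> filtration (i + (m + n))"
        using D E that unfolding shifting_derivations_def add.commute[of m] add.assoc[symmetric] by blast
      show "E (D x) \<in> filtration (i + (m + n))"
        using D E that unfolding shifting_derivations_def add.assoc[symmetric] by blast
    qed
    then show "D \<otimes>\<^bsub>rel_Der scale B\<^esub> E \<in> shifting_derivations (m + n)"
      using D E bracket_closed[of D E] by (simp add: shifting_derivations_def rel_Der_simps)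
  next
    have "D x = 0" if "D \<in> shifting_derivations (Suc N)" for D x
    proof -
      \<comment> \<open>Every \<open>x\<close> lies in \<open>filtration 0\<close>, so a shift
        beyond \<open>N\<close> forces \<open>D x = 0\<close>.\<close>
      have "D x \<in> filtration (0 + Suc N)"
        using that UNIV_I[of x] unfolding shifting_derivations_def filtration_0[symmetric] by blast
      then show ?thesis using filtration_antimono[of N "Suc N"] N by auto
    qed
    then show "shifting_derivations (Suc N) = {\<zero>\<^bsub>rel_Der scale B\<^esub>}"
      using closed(1) by (auto simp: rel_Der_simps)
  qed
qed

end

section \<open>Relative Hochschild cohomology from the quiver data\<close>

theorem theorem4p5:
  fixes scale :: "'k::alg_closed_field \<Rightarrow> 'a::ring_1 \<Rightarrow> 'a"
    and B :: "'a set"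
    and Q\<^sub>A Q\<^sub>B Q\<^sub>C :: "('v, 'e) pre_digraph"
    and \<nu>\<^sub>A \<nu>\<^sub>B :: "(('v, 'e) qpath \<Rightarrow>\<^sub>0 'k) \<Rightarrow> 'a"
  assumes "CHAR('k) > 0"
    and "k_algebra scale" and "finite_dimensional scale"
    and "basic_algebra (UNIV :: 'a set)"
    and "gabriel_quiver scale UNIV Q\<^sub>A" and "loopfree_digraph Q\<^sub>A"
    and "subalgebra scale B"
    and "gabriel_quiver scale B Q\<^sub>B"
    and "spanning Q\<^sub>B Q\<^sub>A"
    and "admissible_presentation scale UNIV Q\<^sub>A \<nu>\<^sub>A"
    and "admissible_presentation scale B Q\<^sub>B \<nu>\<^sub>B"
    and "\<And>f. f \<in> carrier (path_algebra Q\<^sub>B) \<Longrightarrow> \<nu>\<^sub>A f = \<nu>\<^sub>B f"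
    and "Q\<^sub>C = Q\<^sub>A\<lparr>arcs := arcs Q\<^sub>A - arcs Q\<^sub>B\<rparr>"
    and "digraph Q\<^sub>C"
  shows "strongly_solvable_lie_algebra (ring_on (UNIV :: 'k set)) (rel_HH1 scale B)"
proof -
  interpret k_algebra scale by fact
  interpret A: loopfree_digraph Q\<^sub>A by fact
  interpret presented_algebra scale Q\<^sub>A \<nu>\<^sub>A
    by unfold_locales fact
  interpret C: digraph Q\<^sub>C by fact
  have spanning: "verts Q\<^sub>A = verts Q\<^sub>B" "tail Q\<^sub>B = tail Q\<^sub>A" "head Q\<^sub>B = head Q\<^sub>A" "wf_digraph Q\<^sub>B"
    using \<open>spanning Q\<^sub>B Q\<^sub>A\<close> by (auto simp: spanning_def subgraph_def compatible_def)
  interpret B: wf_digraph Q\<^sub>B by fact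
  \<comment> \<open>On paths of \<open>Q\<^sub>B\<close> the map \<open>\<nu>\<^sub>A\<close> agrees
    with \<open>\<nu>\<^sub>B\<close>, whose image is \<open>B\<close>.\<close>
  have path_image_mem: "path_image u p v \<in> B" if "B.awalk u p v" for u p v
  proof -
    have f: "Poly_Mapping.single (u, p, v) (1 :: 'k) \<in> carrier (path_algebra Q\<^sub>B)"
      using that by (rule single_mem_path_algebra)
    then show ?thesis
      using assms(11) assms(12)[OF f] by (auto simp: path_image_def admissible_presentation_def)
  qed
  have "relative_presentation scale Q\<^sub>A \<nu>\<^sub>A B (arcs Q\<^sub>B)"
  proof unfold_locales
    show "path_image u [] u \<in> B" if "u \<in> verts Q\<^sub>A" for u
      using that by (intro path_image_mem) (simp add: B.awalk_Nil_iff spanning)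
    show "path_image (tail Q\<^sub>A a) [a] (head Q\<^sub>A a) \<in> B" if "a \<in> arcs Q\<^sub>B" for a
      using that B.tail_in_verts[of a] by (intro path_image_mem) (simp add: B.awalk_def B.cas.simps spanning(2,3))
    show "a = b" if "a \<in> arcs Q\<^sub>A - arcs Q\<^sub>B" "b \<in> arcs Q\<^sub>A - arcs Q\<^sub>B"
      "tail Q\<^sub>A a = tail Q\<^sub>A b" "head Q\<^sub>A a = head Q\<^sub>A b" for a b
      \<comment> \<open>Both arrows belong to \<open>Q\<^sub>C\<close>, whose simplicity forbids
        distinct arrows with equal ends.\<close>
      using that C.no_multi_arcs[of a b] by (simp add: assms(13) arc_to_ends_def)
  qed
  then show ?thesis by (rule relative_presentation.strongly_solvable_rel_HH1)
qed

end
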